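(* For all integers $n\geq 0$ and $k\geq 0$, \begin{align*} \overline{OPT}_{2k+1}(8n+1)&\equiv 0 \pmod 2,\\ \overline{OPT}_{2k+1}(8n+2)&\equiv 0 \pmod 2,\\ \overline{OPT}_{2k+1}(8n+3)&\equiv 0 \pmod 4,\\ \overline{OPT}_{2k+1}(8n+4)&\equiv 0 \pmod 2,\\ \overline{OPT}_{2k+1}(8n+5)&\equiv 0 \pmod 8,\\ \overline{OPT}_{2k+1}(8n+6)&\equiv 0 \pmod 4,\\ \overline{OPT}_{2k+1}(8n+7)&\equiv 0 \pmod{16}. \end{align*}
   Context: An overpartition of a nonnegative integer $n$ is a non-increasing sequence of positive integers with sum $n$ in which the first occurrence of each number may be overlined. For an integer $k\geq 1$, an overpartition $k$-tuple of $n$ with odd parts is an (ordered) $k$-tuple $(\xi_1,\ldots,\xi_k)$ of overpartitions, all of whose parts are odd, such that the sum of all the parts of $\xi_1,\ldots,\xi_k$ is $n$. $\overline{OPT}_k(n)$ denotes the number of overpartition $k$-tuples of $n$ with odd parts. Its generating function is $$\sum_{n\geq 0}\overline{OPT}_k(n)q^n=\frac{f_2^{3k}}{f_1^{2k}f_4^k}=\prod_{i\geq 0}\left(\frac{1+q^{2i+1}}{1-q^{2i+1}}\right)^k,\qquad f_j:=\prod_{i\geq 1}(1-q^{ji}).$$ *)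

theory Defs
  imports "HOL-Number_Theory.Cong"
begin

(* An overpartition is the list of its parts in non-increasing order;
   the entry (p, b) is the part p, overlined iff b. *)

type_synonym overparts = "(nat \<times> bool) list"

definition is_overpartition :: "overparts \<Rightarrow> bool" where
  "is_overpartition xs \<longleftrightarrow>
     sorted_wrt (\<ge>) (map fst xs) \<and>
     (\<forall>i<length xs. fst (xs ! i) > 0) \<and>
     (\<forall>i<length xs. snd (xs ! i) \<longrightarrow> (\<forall>j<i. fst (xs ! j) \<noteq> fst (xs ! i)))"

definition odd_parts :: "overparts \<Rightarrow> bool" where
  "odd_parts xs \<longleftrightarrow> (\<forall>i<length xs. odd (fst (xs ! i)))"

definition parts_sum :: "overparts \<Rightarrow> nat" where
  "parts_sum xs = sum_list (map fst xs)"

definition odd_overpartition_tuples :: "nat \<Rightarrow> nat \<Rightarrow> overparts list set" where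
  "odd_overpartition_tuples k n =
     {\<xi>s. length \<xi>s = k \<and>
          (\<forall>\<xi>\<in>set \<xi>s. is_overpartition \<xi> \<and> odd_parts \<xi>) \<and>
          sum_list (map parts_sum \<xi>s) = n}"

definition OPT :: "nat \<Rightarrow> nat \<Rightarrow> nat" where
  "OPT k n = card (odd_overpartition_tuples k n)"

lemma length_le_parts_sum:
  assumes "is_overpartition xs"
  shows "length xs \<le> parts_sum xs"
proof -
  have "\<forall>x\<in>set xs. fst x \<ge> 1"
    using assms by (fastforce simp: is_overpartition_def in_set_conv_nth)
  then show ?thesis
    unfolding parts_sum_def by (induction xs) auto
qed

(* So card in OPT is never the junk value 0 of an infinite set. *)
lemma finite_odd_overpartition_tuples: "finite (odd_overpartition_tuples k n)"
proof -
  let ?A = "{xs :: overparts. set xs \<subseteq> {..n} \<times> UNIV \<and> length xs \<le> n}"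
  have A: "finite ?A"
    by (rule finite_lists_length_le) simp
  have "odd_overpartition_tuples k n \<subseteq> {\<xi>s. set \<xi>s \<subseteq> ?A \<and> length \<xi>s = k}"
  proof
    fix \<xi>s assume *: "\<xi>s \<in> odd_overpartition_tuples k n"
    have "xs \<in> ?A" if "xs \<in> set \<xi>s" for xs
    proof -
      have le: "parts_sum xs \<le> n"
        using * that member_le_sum_list[of "parts_sum xs" "map parts_sum \<xi>s"]
        by (auto simp: odd_overpartition_tuples_def)
      have "length xs \<le> n"
        using * that le length_le_parts_sum[of xs]
        by (auto simp: odd_overpartition_tuples_def)
      moreover have "fst x \<le> n" if "x \<in> set xs" for x
        using that le member_le_sum_list[of "fst x" "map fst xs"]
        by (auto simp: parts_sum_def)
      ultimately show ?thesis by auto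
    qed
    then show "\<xi>s \<in> {\<xi>s. set \<xi>s \<subseteq> ?A \<and> length \<xi>s = k}"
      using * by (auto simp: odd_overpartition_tuples_def)
  qed
  then show ?thesis
    using finite_lists_length_eq[OF A] finite_subset by blast
qed

end

theory Submission
  imports Defs "HOL-Computational_Algebra.Formal_Power_Series"
    "HOL-Computational_Algebra.Nth_Powers"
begin

text \<open>
  With \<open>\<phi>(q) = \<Sum> q^(s^2)\<close> over all integers \<open>s\<close>, Gauss' product gives
  \<open>P(q) \<phi>(-q) = \<phi>(-q^2)\<close> for the generating function \<open>P\<close> of overpartitions into odd parts.
  Since \<open>P(q) P(-q) = 1\<close>, also \<open>\<phi>(q) \<phi>(-q) = \<phi>(-q^2)^2\<close>, and iterating this yields
  \<open>P(q) \<phi>(-q^8)^4 = \<phi>(q) \<phi>(q^2) \<phi>(q^4)^2\<close>. The factor \<open>\<phi>(-q^8)^4\<close> is a unit that does not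
  mix residue classes of exponents mod 8, so the powers of 2 dividing the coefficients of \<open>P\<close> and
  \<open>P^2\<close> in each class can be read off from the right-hand side: squares are 0, 1 or 4 mod 8 and
  \<open>\<phi> = 1 + 2S\<close>. Multiplication by \<open>P^2\<close> preserves the bounds for \<open>P\<close>, hence they hold for
  every odd power of \<open>P\<close>.
\<close>

unbundle fps_syntax

section \<open>Gauss' product for the alternating theta series\<close>

text \<open>The last product runs over i < s and so includes i = 0, which contributes the factor 2
  of every term with s > 0; for s = 0 it is empty.\<close>

definition shanks_term :: "'a::comm_ring_1 \<Rightarrow> nat \<Rightarrow> nat \<Rightarrow> 'a" where
  "shanks_term q n s =
     (-1) ^ s * q ^ (s * (n + 1)) * (\<Prod>i=s+1..n. 1 - q ^ i) * (\<Prod>i<s. 1 + q ^ i)"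

text \<open>Certificate for telescoping in s: for s <= n it is \<open>shanks_term q n s\<close>
  times 1 - q^s, so it vanishes at s = 0.\<close>

definition shanks_aux :: "'a::comm_ring_1 \<Rightarrow> nat \<Rightarrow> nat \<Rightarrow> 'a" where
  "shanks_aux q n s =
     (-1) ^ s * q ^ (s * (n + 1)) * (\<Prod>i=s..n. 1 - q ^ i) * (\<Prod>i<s. 1 + q ^ i)"

text \<open>After removing the common factor (-1)^s \<open>z * A * B\<close>, both sides equal q^s -
  1 - q^(n+1) - q^(n+1+s).\<close>

lemma shanks_term_diff:
  fixes q :: "'a::comm_ring_1"
  assumes "s \<le> n"
  shows "shanks_term q (Suc n) s - (1 + q ^ Suc n) * shanks_term q n s =
         shanks_aux q n (Suc s) - shanks_aux q n s"
proof -
  define A where "A = (\<Prod>i=Suc s..n. 1 - q ^ i)"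
  define B where "B = (\<Prod>i<s. 1 + q ^ i)"
  define z where "z = q ^ (s * (n + 1))"
  have 1: "(\<Prod>i=s..n. 1 - q ^ i) = (1 - q ^ s) * A"
    unfolding A_def using assms by (simp add: prod.atLeast_Suc_atMost)
  have 2: "(\<Prod>i=Suc s..Suc n. 1 - q ^ i) = A * (1 - q ^ Suc n)"
    unfolding A_def using assms by (simp add: prod.nat_ivl_Suc' mult.commute)
  have 3: "(\<Prod>i<Suc s. 1 + q ^ i) = B * (1 + q ^ s)"
    unfolding B_def by simp
  have 4: "q ^ (s * (Suc n + 1)) = z * q ^ s" "q ^ (Suc s * (n + 1)) = z * q ^ Suc n"
    unfolding z_def by (simp_all flip: power_add add: algebra_simps)
  show ?thesis
    unfolding shanks_term_def shanks_aux_def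
    by (simp only: Suc_eq_plus1[symmetric] 1 2 3 4[unfolded Suc_eq_plus1[symmetric]] flip: A_def B_def)
      (simp add: z_def algebra_simps)
qed

text \<open>Shanks' finite form of Gauss' theorem, cleared of denominators: every term with
  \<open>s > 0\<close> is a multiple of \<open>q ^ (n + 1)\<close>.\<close>

lemma shanks_identity:
  fixes q :: "'a::comm_ring_1"
  shows "(1 + (\<Sum>s=1..n. 2 * (-1) ^ s * q ^ (s\<^sup>2))) * (\<Prod>i=1..n. 1 + q ^ i) =
         (\<Sum>s\<le>n. shanks_term q n s)"
proof (induction n)
  case 0
  show ?case by (simp add: shanks_term_def)
next
  case (Suc n)
  define b where "b = (\<Prod>i=1..n. 1 + q ^ i)"
  have b: "(\<Prod>i<Suc n. 1 + q ^ i) = 2 * b"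
    unfolding b_def prod.lessThan_Suc_shift
    by (simp add: prod.atLeast1_atMost_eq)
  have "(\<Sum>s\<le>n. shanks_term q (Suc n) s) - (1 + q ^ Suc n) * (\<Sum>s\<le>n. shanks_term q n s)
      = (\<Sum>s\<le>n. shanks_aux q n (Suc s) - shanks_aux q n s)"
    unfolding sum_distrib_left sum_subtractf[symmetric]
    by (intro sum.cong refl shanks_term_diff) simp
  also have "\<dots> = shanks_aux q n (Suc n) - shanks_aux q n 0"
    by (rule sum_telescope[of "\<lambda>s. - shanks_aux q n s" n, simplified])
  also have "shanks_aux q n 0 = 0"
    by (simp add: shanks_aux_def prod.atLeast_Suc_atMost)
  also have "shanks_aux q n (Suc n) = (-1) ^ Suc n * q ^ ((Suc n)\<^sup>2) * (2 * b)"
    unfolding shanks_aux_def b by (simp add: power2_eq_square)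
  finally have 1: "(\<Sum>s\<le>n. shanks_term q (Suc n) s) =
      (1 + q ^ Suc n) * (\<Sum>s\<le>n. shanks_term q n s) + (-1) ^ Suc n * q ^ ((Suc n)\<^sup>2) * (2 * b)"
    by (simp add: algebra_simps)
  have 2: "shanks_term q (Suc n) (Suc n) =
      (-1) ^ Suc n * q ^ ((Suc n)\<^sup>2) * q ^ Suc n * (2 * b)"
    unfolding shanks_term_def b by (simp add: power2_eq_square power_add algebra_simps)
  \<comment> \<open>The boundary term of the telescoping sum and the new summand s = n + 1 differ
    only by the factor q^(n+1), so together they produce 1 + q^(n+1).\<close>
  have "(\<Sum>s\<le>Suc n. shanks_term q (Suc n) s) =
      (1 + q ^ Suc n) * (\<Sum>s\<le>n. shanks_term q n s) +
      (1 + q ^ Suc n) * (2 * (-1) ^ Suc n * q ^ ((Suc n)\<^sup>2)) * b"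
    unfolding sum.atMost_Suc 1 2 by (simp only: algebra_simps mult_1_left mult_1_right)
  also have "\<dots> = (1 + q ^ Suc n) * ((1 + (\<Sum>s=1..n. 2 * (-1) ^ s * q ^ (s\<^sup>2))) * b) +
      (1 + q ^ Suc n) * (2 * (-1) ^ Suc n * q ^ ((Suc n)\<^sup>2)) * b"
    using Suc.IH unfolding b_def by simp
  also have "\<dots> = (1 + (\<Sum>s=1..Suc n. 2 * (-1) ^ s * q ^ (s\<^sup>2))) * (b * (1 + q ^ Suc n))"
    by (simp add: algebra_simps)
  also have "b * (1 + q ^ Suc n) = (\<Prod>i=1..Suc n. 1 + q ^ i)"
    unfolding b_def by simp
  finally show ?case by simp
qed

text \<open>The term s = 0 is exactly the product of the 1 - q^i. This is Gauss' identity modulo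
  q^(n+1), with finite products only.\<close>

lemma shanks_dvd:
  fixes q :: "'a::comm_ring_1"
  shows "q ^ Suc n dvd (1 + (\<Sum>s=1..n. 2 * (-1) ^ s * q ^ (s\<^sup>2))) * (\<Prod>i=1..n. 1 + q ^ i)
           - (\<Prod>i=1..n. 1 - q ^ i)"
proof -
  have "(\<Sum>s\<le>n. shanks_term q n s) = shanks_term q n 0 + (\<Sum>s=1..n. shanks_term q n s)"
    by (simp add: sum.atLeast1_atMost_eq sum.atMost_shift lessThan_Suc_atMost)
  moreover have "q ^ Suc n dvd (\<Sum>s=1..n. shanks_term q n s)"
  proof (rule dvd_sum)
    fix s assume "s \<in> {1..n}"
    then have "q ^ Suc n dvd q ^ (s * (n + 1))"
      using mult_le_mono1[of 1 s "n + 1"] by (intro le_imp_power_dvd) auto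
    then show "q ^ Suc n dvd shanks_term q n s"
      unfolding shanks_term_def by (simp add: dvd_mult dvd_mult2)
  qed
  ultimately show ?thesis
    unfolding shanks_identity by (simp add: shanks_term_def)
qed

section \<open>The theta series and agreement modulo powers of \<open>fps_X\<close>\<close>

definition theta :: "int fps" where
  "theta = Abs_fps (\<lambda>n. if n = 0 then 1 else if is_square n then 2 else 0)"

text \<open>Divisibility of a difference by a power of \<open>fps_X\<close> means agreement of the
  low coefficients; it takes the place of convergence of infinite products.\<close>

lemma fps_X_power_dvd_iff:
  fixes f :: "'a::comm_ring_1 fps"
  shows "fps_X ^ k dvd f \<longleftrightarrow> (\<forall>n<k. f $ n = 0)"
proof
  assume "fps_X ^ k dvd f"
  then show "\<forall>n<k. f $ n = 0" by (auto simp: fps_X_power_mult_nth)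
next
  assume *: "\<forall>n<k. f $ n = 0"
  have "f = fps_X ^ k * fps_shift k f"
    using * by (intro fps_ext) (auto simp: fps_X_power_mult_nth)
  then show "fps_X ^ k dvd f" by (rule dvdI)
qed

text \<open>Subdegrees add over an integral domain, and \<open>g\<close> has subdegree 0. This
  removes denominators with nonzero constant term.\<close>

lemma fps_X_power_dvd_mult_cancel:
  fixes f g :: "'a::idom fps"
  assumes "fps_X ^ k dvd f * g" "g $ 0 \<noteq> 0"
  shows "fps_X ^ k dvd f"
proof (cases "f = 0")
  case False
  have g: "g \<noteq> 0" "subdegree g = 0"
    using assms(2) by auto
  obtain h where h: "f * g = fps_X ^ k * h" using assms(1) by (elim dvdE)
  with False g have "h \<noteq> 0" by auto
  then have "subdegree (f * g) = k + subdegree h"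
    unfolding h by (simp add: fps_X_power_subdegree)
  then have "k \<le> subdegree f"
    using False g by simp
  then show ?thesis
    unfolding fps_X_power_dvd_iff by (auto intro: nth_less_subdegree_zero)
qed simp

text \<open>Even exponents suffice, and they are what truncation to the first N odd factors
  provides.\<close>

lemma fps_eq_0_if_X_power_dvd:
  fixes f :: "'a::comm_ring_1 fps"
  assumes "\<And>k. fps_X ^ (2 * k) dvd f"
  shows "f = 0"
proof (rule fps_ext)
  fix n show "f $ n = 0 $ n"
    using assms[of "Suc n"] unfolding fps_X_power_dvd_iff by auto
qed

lemma fps_compose_dvd:
  fixes f g c :: "'a::idom fps"
  assumes "f dvd g" "c $ 0 = 0"
  shows "(f oo c) dvd (g oo c)"
  using assms by (auto simp: fps_compose_mult_distrib elim!: dvdE)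

text \<open>Up to degree n only squares of s <= n occur, so the finite sum of
  \<open>shanks_dvd\<close> agrees there with the series at -q; the signs match because s and s^2
  have the same parity.\<close>

lemma alternating_theta_dvd:
  "fps_X ^ Suc n dvd (theta oo - fps_X) * (\<Prod>i=1..n. 1 + fps_X ^ i) - (\<Prod>i=1..n. 1 - fps_X ^ i)"
proof -
  define T :: "int fps" where "T = 1 + (\<Sum>s=1..n. 2 * (-1) ^ s * fps_X ^ (s\<^sup>2))"
  have "T $ m = (-1) ^ m * theta $ m" if "m \<le> n" for m
  proof -
    have c: "(2 * (-1) ^ s * fps_X ^ k :: int fps) $ m = (if m = k then 2 * (-1) ^ s else 0)" for s k
    proof -
      have eq: "(2 * (-1) ^ s * fps_X ^ k :: int fps) = fps_const (2 * (-1) ^ s) * fps_X ^ k"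
        by (simp only: fps_const_mult[symmetric] fps_const_power[symmetric] fps_const_neg[symmetric]
            numeral_fps_const[symmetric] fps_const_1_eq_1)
      show ?thesis unfolding eq by simp
    qed
    have "T $ m = (if m = 0 then 1 else 0) + (\<Sum>s=1..n. if m = s\<^sup>2 then 2 * (-1) ^ s else 0)"
      unfolding T_def by (simp add: fps_sum_nth c)
    also have "\<dots> = (-1) ^ m * theta $ m"
    proof (cases "m \<noteq> 0 \<and> is_square m")
      case True
      then obtain t where t: "m = t\<^sup>2" "t \<noteq> 0" by (auto elim: is_nth_powerE)
      have "t \<le> n" using that t by (meson le_trans power2_nat_le_imp_le le_refl)
      have "(\<Sum>s=1..n. if m = s\<^sup>2 then 2 * (-1) ^ s else (0::int)) =
            (\<Sum>s=1..n. if s = t then 2 * (-1) ^ s else 0)"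
        unfolding t by (intro sum.cong) auto
      also have "\<dots> = 2 * (-1) ^ t" using \<open>t \<le> n\<close> t by simp
      also have "(-1) ^ t = (-1 :: int) ^ m" unfolding t by (simp add: minus_one_power_iff)
      finally show ?thesis using True by (simp add: theta_def)
    next
      case False
      then have "(\<Sum>s=1..n. if m = s\<^sup>2 then 2 * (-1) ^ s else (0::int)) = 0"
        by (intro sum.neutral) auto
      then show ?thesis using False by (auto simp: theta_def)
    qed
    finally show ?thesis .
  qed
  then have "fps_X ^ Suc n dvd (theta oo - fps_X) - T"
    unfolding fps_X_power_dvd_iff fps_compose_uminus' by simp
  then have "fps_X ^ Suc n dvd ((theta oo - fps_X) - T) * (\<Prod>i=1..n. 1 + fps_X ^ i)"
    by (rule dvd_mult2)
  moreover have "fps_X ^ Suc n dvd T * (\<Prod>i=1..n. 1 + fps_X ^ i) - (\<Prod>i=1..n. 1 - fps_X ^ i)"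
    unfolding T_def by (rule shanks_dvd)
  ultimately have "fps_X ^ Suc n dvd ((theta oo - fps_X) - T) * (\<Prod>i=1..n. 1 + fps_X ^ i) +
      (T * (\<Prod>i=1..n. 1 + fps_X ^ i) - (\<Prod>i=1..n. 1 - fps_X ^ i))"
    by (rule dvd_add)
  then show ?thesis by (simp only: left_diff_distrib diff_add_cancel add_diff_eq)
qed

section \<open>The generating function\<close>

lemma is_overpartition_Nil [simp]: "is_overpartition []"
  by (simp add: is_overpartition_def)

text \<open>The head may always be overlined, being a first occurrence; a later entry equal to it
  may not.\<close>

lemma is_overpartition_Cons:
  "is_overpartition (x # xs) \<longleftrightarrow>
     is_overpartition xs \<and> fst x > 0 \<and> (\<forall>y\<in>set xs. fst y \<le> fst x \<and> (snd y \<longrightarrow> fst y \<noteq> fst x))"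
  unfolding is_overpartition_def all_set_conv_all_nth length_Cons All_less_Suc2
  by (auto simp: all_set_conv_all_nth)

lemma odd_parts_Nil [simp]: "odd_parts []"
  by (simp add: odd_parts_def)

lemma odd_parts_Cons [simp]: "odd_parts (x # xs) \<longleftrightarrow> odd (fst x) \<and> odd_parts xs"
  unfolding odd_parts_def length_Cons All_less_Suc2 by simp

lemma parts_sum_Nil [simp]: "parts_sum [] = 0"
  and parts_sum_Cons [simp]: "parts_sum (x # xs) = fst x + parts_sum xs"
  by (simp_all add: parts_sum_def)

definition odd_overpartitions :: "nat \<Rightarrow> overparts set" where
  "odd_overpartitions n = {xs. is_overpartition xs \<and> odd_parts xs \<and> parts_sum xs = n}"

lemma finite_odd_overpartitions [simp]: "finite (odd_overpartitions n)"
proof (rule finite_imageD)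
  have "(\<lambda>x. [x]) ` odd_overpartitions n \<subseteq> odd_overpartition_tuples 1 n"
    by (auto simp: odd_overpartitions_def odd_overpartition_tuples_def)
  then show "finite ((\<lambda>x. [x]) ` odd_overpartitions n)"
    by (rule finite_subset) (rule finite_odd_overpartition_tuples)
qed (simp add: inj_on_def)

definition OPF :: "int fps" where
  "OPF = Abs_fps (\<lambda>n. int (card (odd_overpartitions n)))"

lemma odd_overpartition_tuples_Suc:
  "odd_overpartition_tuples (Suc k) n =
     (\<lambda>(i, x, xs). x # xs) `
       (SIGMA i:{0..n}. odd_overpartitions i \<times> odd_overpartition_tuples k (n - i))"
proof (intro equalityI subsetI)
  fix \<xi>s assume *: "\<xi>s \<in> odd_overpartition_tuples (Suc k) n"
  then obtain x xs where \<xi>s: "\<xi>s = x # xs"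
    unfolding odd_overpartition_tuples_def by (cases \<xi>s) auto
  show "\<xi>s \<in> (\<lambda>(i, x, xs). x # xs) `
       (SIGMA i:{0..n}. odd_overpartitions i \<times> odd_overpartition_tuples k (n - i))"
    using * unfolding \<xi>s
    by (intro image_eqI[where x = "(parts_sum x, x, xs)"])
      (auto simp: odd_overpartition_tuples_def odd_overpartitions_def)
qed (auto simp: odd_overpartition_tuples_def odd_overpartitions_def)

text \<open>Splitting off the first component of a tuple turns the count into a Cauchy
  product.\<close>

lemma OPT_eq_fps_nth: "int (OPT k n) = OPF ^ k $ n"
proof (induction k arbitrary: n)
  case 0
  have "odd_overpartition_tuples 0 n = (if n = 0 then {[]} else {})"
    by (auto simp: odd_overpartition_tuples_def)
  then show ?case by (simp add: OPT_def)
next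
  case (Suc k)
  have "inj_on (\<lambda>(i, x, xs). x # xs)
      (SIGMA i:{0..n}. odd_overpartitions i \<times> odd_overpartition_tuples k (n - i))"
    by (auto simp: inj_on_def odd_overpartitions_def)
  then have "OPT (Suc k) n = (\<Sum>i=0..n. card (odd_overpartitions i) * OPT k (n - i))"
    unfolding OPT_def odd_overpartition_tuples_Suc
    by (simp add: card_image card_SigmaI finite_odd_overpartition_tuples card_cartesian_product)
  then show ?case
    using Suc by (simp add: fps_mult_nth OPF_def)
qed

section \<open>Overpartitions with bounded odd parts and their finite products\<close>

definition bounded_overpartitions :: "nat \<Rightarrow> nat \<Rightarrow> overparts set" where
  "bounded_overpartitions N n = {xs \<in> odd_overpartitions n. \<forall>x\<in>set xs. fst x < 2 * N}"

definition OPF_bounded :: "nat \<Rightarrow> int fps" where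
  "OPF_bounded N = Abs_fps (\<lambda>n. int (card (bounded_overpartitions N n)))"

lemma finite_bounded_overpartitions [simp]: "finite (bounded_overpartitions N n)"
  by (simp add: bounded_overpartitions_def)

lemma OPF_bounded_0: "OPF_bounded 0 = 1"
proof (rule fps_ext)
  fix n
  have "xs \<in> bounded_overpartitions 0 n \<longleftrightarrow> xs = [] \<and> n = 0" for xs
    by (cases xs) (auto simp: bounded_overpartitions_def odd_overpartitions_def)
  then have "bounded_overpartitions 0 n = (if n = 0 then {[]} else {})"
    by auto
  then show "OPF_bounded 0 $ n = 1 $ n" by (simp add: OPF_bounded_def)
qed

text \<open>\<open>C\<close> counts the overpartitions in which the new largest part may occur but is
  not overlined; prepending one more copy, overlined or not, gives all the others.\<close>

lemma OPF_bounded_Suc: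
  "OPF_bounded (Suc N) * (1 - fps_X ^ (2 * N + 1)) = OPF_bounded N * (1 + fps_X ^ (2 * N + 1))"
proof -
  \<comment> \<open>This is the only odd number below 2 (N + 1) that is not already below 2
    N.\<close>
  define p where "p = 2 * N + 1"
  define CS where "CS n = {xs \<in> bounded_overpartitions (Suc N) n. (p, True) \<notin> set xs}" for n
  define C :: "int fps" where "C = Abs_fps (\<lambda>n. int (card (CS n)))"
  have fin: "finite (CS n)" for n by (simp add: CS_def)
  have bound: "(a, b) # xs \<in> bounded_overpartitions M n \<longleftrightarrow>
      (a, b) # xs \<in> odd_overpartitions n \<and> a < 2 * M" for a b xs M n
    unfolding bounded_overpartitions_def odd_overpartitions_def
    by (auto simp: is_overpartition_Cons intro: le_less_trans)
  \<comment> \<open>Behind a leading \<open>p\<close>, overlined or not, no entry \<open>p\<close>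
    may be overlined: hence the tail lies in \<open>CS\<close>.\<close>
  have cons: "(a, b) # xs \<in> bounded_overpartitions (Suc N) n \<longleftrightarrow>
      (if a = p then p \<le> n \<and> xs \<in> CS (n - p) else (a, b) # xs \<in> bounded_overpartitions N n)"
    for a b xs n
  proof (cases "a = p")
    case True
    have 1: "y \<le> p \<longleftrightarrow> y < 2 * Suc N" for y
      unfolding p_def by auto
    have 2: "odd p" "p > 0" "p < 2 * Suc N" by (simp_all add: p_def)
    have 3: "(\<forall>y\<in>set xs. snd y \<longrightarrow> fst y \<noteq> p) \<longleftrightarrow> (p, True) \<notin> set xs" by force
    show ?thesis
      using 2 unfolding bound unfolding CS_def bounded_overpartitions_def odd_overpartitions_def
      by (auto simp: True is_overpartition_Cons ball_conj_distrib 1 3)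
  next
    case False
    have "odd a \<Longrightarrow> a < 2 * Suc N \<longleftrightarrow> a < 2 * N"
      using False unfolding p_def by (auto elim!: oddE)
    then show ?thesis
      using False unfolding bound by (auto simp: odd_overpartitions_def)
  qed
  have notin: "(p, b) # xs \<notin> bounded_overpartitions N n" for b xs n
    by (simp add: bounded_overpartitions_def p_def)
  have nil: "[] \<in> bounded_overpartitions (Suc N) n \<longleftrightarrow> [] \<in> bounded_overpartitions N n" for n
    by (simp add: bounded_overpartitions_def)
  have mem: "xs \<in> bounded_overpartitions (Suc N) n \<longleftrightarrow> xs \<in> bounded_overpartitions N n \<or>
      (p \<le> n \<and> (\<exists>ys\<in>CS (n - p). \<exists>b. xs = (p, b) # ys))" for xs n
    by (cases xs) (auto simp: nil cons notin split: if_splits)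
  have notp: "(p, b) \<notin> set xs" if "xs \<in> bounded_overpartitions N n" for xs n b
    using that by (auto simp: bounded_overpartitions_def p_def)
  have B: "bounded_overpartitions (Suc N) n = bounded_overpartitions N n \<union>
      (if n < p then {} else Cons (p, True) ` CS (n - p) \<union> Cons (p, False) ` CS (n - p))" for n
    by (rule set_eqI) (auto simp: mem ex_bool_eq)
  have mCS: "xs \<in> CS n \<longleftrightarrow> xs \<in> bounded_overpartitions (Suc N) n \<and> (p, True) \<notin> set xs" for xs n
    by (simp add: CS_def)
  have Ceq: "CS n = bounded_overpartitions N n \<union>
      (if n < p then {} else Cons (p, False) ` CS (n - p))" for n
  proof (rule set_eqI)
    fix xs
    have "ys \<in> CS (n - p) \<Longrightarrow> (p, True) \<notin> set ys" for ys by (simp add: CS_def)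
    then show "xs \<in> CS n \<longleftrightarrow> xs \<in> bounded_overpartitions N n \<union>
      (if n < p then {} else Cons (p, False) ` CS (n - p))"
      using notp[of xs n True] unfolding mCS[of xs n] mem[of xs n] by auto
  qed
  have 1: "OPF_bounded (Suc N) = OPF_bounded N + (fps_X ^ p * C + fps_X ^ p * C)"
  proof (rule fps_ext)
    fix n
    have "card (bounded_overpartitions (Suc N) n) = card (bounded_overpartitions N n) +
        (if n < p then 0 else card (CS (n - p)) + card (CS (n - p)))"
    proof (cases "n < p")
      case False
      have "card (bounded_overpartitions (Suc N) n) = card (bounded_overpartitions N n) +
          card (Cons (p, True) ` CS (n - p) \<union> Cons (p, False) ` CS (n - p))"
        unfolding B using False notin by (simp, subst card_Un_disjoint) (auto simp: fin)
      also have "card (Cons (p, True) ` CS (n - p) \<union> Cons (p, False) ` CS (n - p)) =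
          card (CS (n - p)) + card (CS (n - p))"
        by (subst card_Un_disjoint) (auto simp: fin card_image)
      finally show ?thesis using False by simp
    qed (simp add: B)
    then show "OPF_bounded (Suc N) $ n = (OPF_bounded N + (fps_X ^ p * C + fps_X ^ p * C)) $ n"
      unfolding fps_add_nth fps_X_power_mult_nth by (simp add: OPF_bounded_def C_def)
  qed
  have 2: "C = OPF_bounded N + fps_X ^ p * C"
  proof (rule fps_ext)
    fix n
    have "card (CS n) = card (bounded_overpartitions N n) +
        (if n < p then 0 else card (CS (n - p)))"
    proof (cases "n < p")
      case False
      have "card (CS n) = card (bounded_overpartitions N n) + card (Cons (p, False) ` CS (n - p))"
        unfolding Ceq[of n] using False notin by (simp, subst card_Un_disjoint) (auto simp: fin)
      then show ?thesis using False by (simp add: card_image)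
    qed (simp add: Ceq[of n])
    then show "C $ n = (OPF_bounded N + fps_X ^ p * C) $ n"
      unfolding fps_add_nth fps_X_power_mult_nth by (simp add: OPF_bounded_def C_def)
  qed
  \<comment> \<open>Eliminating \<open>C\<close>: the old series is \<open>C\<close> times 1 - X^p,
    so the new one is \<open>C\<close> times (1 - X^p) + 2 X^p = 1 + X^p.\<close>
  have 3: "OPF_bounded N = C * (1 - fps_X ^ p)" using 2 by (simp add: algebra_simps)
  show ?thesis unfolding p_def[symmetric] 1 3 by (simp add: algebra_simps)
qed

lemma OPF_bounded_prod:
  "OPF_bounded N * (\<Prod>i<N. 1 - fps_X ^ (2 * i + 1)) = (\<Prod>i<N. 1 + fps_X ^ (2 * i + 1))"
proof (induction N)
  case (Suc N)
  let ?A = "\<Prod>i<N. 1 - fps_X ^ (2 * i + 1) :: int fps"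
  have "OPF_bounded (Suc N) * (\<Prod>i<Suc N. 1 - fps_X ^ (2 * i + 1)) =
      OPF_bounded (Suc N) * (1 - fps_X ^ (2 * N + 1)) * ?A"
    by (simp add: algebra_simps)
  also have "\<dots> = (OPF_bounded N * ?A) * (1 + fps_X ^ (2 * N + 1))"
    unfolding OPF_bounded_Suc by (simp only: mult_ac)
  finally show ?case unfolding Suc.IH by simp
qed (simp add: OPF_bounded_0)

text \<open>Parts of an overpartition of n < 2 N are at most n, so the bound 2 N excludes nothing
  below that degree.\<close>

lemma OPF_dvd:
  "fps_X ^ (2 * N) dvd
     OPF * (\<Prod>i<N. 1 - fps_X ^ (2 * i + 1)) - (\<Prod>i<N. 1 + fps_X ^ (2 * i + 1))"
proof -
  have "bounded_overpartitions N n = odd_overpartitions n" if "n < 2 * N" for n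
  proof -
    have "fst x \<le> n" if "x \<in> set xs" "parts_sum xs = n" for x xs
      using that member_le_sum_list[of "fst x" "map fst xs"] by (auto simp: parts_sum_def)
    then show ?thesis
      using that unfolding bounded_overpartitions_def odd_overpartitions_def by fastforce
  qed
  then have "fps_X ^ (2 * N) dvd OPF - OPF_bounded N"
    unfolding fps_X_power_dvd_iff by (simp add: OPF_def OPF_bounded_def)
  then have "fps_X ^ (2 * N) dvd (OPF - OPF_bounded N) * (\<Prod>i<N. 1 - fps_X ^ (2 * i + 1))"
    by (rule dvd_mult2)
  then show ?thesis by (simp only: left_diff_distrib OPF_bounded_prod)
qed

section \<open>Theta series and the generating function\<close>

lemma prod_split_parity:
  fixes f :: "nat \<Rightarrow> 'a::comm_monoid_mult"
  shows "(\<Prod>i=1..2 * N. f i) = (\<Prod>i=1..N. f (2 * i)) * (\<Prod>i<N. f (2 * i + 1))"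
  by (induction N) (simp_all add: mult_ac)

lemma prod_odd_nth_0:
  "(\<Prod>i<N. 1 + fps_X ^ (2 * i + 1) :: 'a::comm_ring_1 fps) $ 0 = 1"
  by (induction N) auto

lemma prod_even_nth_0:
  "(\<Prod>i=1..N. 1 + fps_X ^ (2 * i) :: 'a::comm_ring_1 fps) $ 0 = 1"
  by (induction N) auto

text \<open>By Gauss, the series at -q is the product of (1 - q^i) / (1 + q^i). The odd i give the
  inverse of \<open>OPF\<close>, the even i give the same product in q^2. All of this is carried out
  modulo X^(2 N).\<close>

lemma OPF_mult_alternating_theta: "OPF * (theta oo - fps_X) = (theta oo - fps_X oo fps_X\<^sup>2)"
proof -
  let ?\<psi> = "theta oo - fps_X"
  let ?\<psi>2 = "theta oo - fps_X oo fps_X\<^sup>2"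
  have "OPF * ?\<psi> - ?\<psi>2 = 0"
  proof (rule fps_eq_0_if_X_power_dvd)
    fix N
    define Om where "Om = (\<Prod>i<N. 1 - fps_X ^ (2 * i + 1) :: int fps)"
    define Op where "Op = (\<Prod>i<N. 1 + fps_X ^ (2 * i + 1) :: int fps)"
    define Em where "Em = (\<Prod>i=1..N. 1 - fps_X ^ (2 * i) :: int fps)"
    define Ep where "Ep = (\<Prod>i=1..N. 1 + fps_X ^ (2 * i) :: int fps)"
    have X2: "(fps_X\<^sup>2 :: int fps) $ 0 = 0" by simp
    have "fps_X ^ Suc (2 * N) dvd ?\<psi> * (Ep * Op) - Em * Om"
      using alternating_theta_dvd[of "2 * N"] unfolding prod_split_parity Om_def Op_def Em_def Ep_def .
    then have 1: "fps_X ^ (2 * N) dvd ?\<psi> * (Ep * Op) - Em * Om"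
      by (rule dvd_trans[rotated]) (simp add: le_imp_power_dvd)
    have pow: "fps_X ^ k oo fps_X\<^sup>2 = (fps_X ^ (2 * k) :: int fps)" for k
      by (simp add: power_mult flip: fps_compose_power)
    have "(fps_X ^ Suc N oo fps_X\<^sup>2) dvd
        ?\<psi> * (\<Prod>i=1..N. 1 + fps_X ^ i) - (\<Prod>i=1..N. 1 - fps_X ^ i) oo fps_X\<^sup>2"
      by (intro fps_compose_dvd alternating_theta_dvd) simp
    then have "fps_X ^ (2 * Suc N) dvd ?\<psi>2 * Ep - Em"
      by (simp only: fps_compose_sub_distrib fps_compose_mult_distrib[OF X2]
          fps_compose_prod_distrib[OF X2] fps_compose_add_distrib fps_compose_1 pow Ep_def Em_def)
    then have 2: "fps_X ^ (2 * N) dvd ?\<psi>2 * Ep - Em"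
      by (rule dvd_trans[rotated]) (simp add: le_imp_power_dvd del: power_Suc)
    have 3: "fps_X ^ (2 * N) dvd OPF * Om - Op"
      using OPF_dvd unfolding Om_def Op_def .
    \<comment> \<open>The three congruences combine linearly to the claim times
      \<open>Ep * Op\<close>, whose constant term 1 permits cancellation.\<close>
    have "(OPF * ?\<psi> - ?\<psi>2) * (Ep * Op) =
        OPF * (?\<psi> * (Ep * Op) - Em * Om) + Em * (OPF * Om - Op) - Op * (?\<psi>2 * Ep - Em)"
      by (simp only: algebra_simps)
    then have "fps_X ^ (2 * N) dvd (OPF * ?\<psi> - ?\<psi>2) * (Ep * Op)"
      using 1 2 3 by (simp only: dvd_add dvd_diff dvd_mult)
    then show "fps_X ^ (2 * N) dvd OPF * ?\<psi> - ?\<psi>2"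
      by (rule fps_X_power_dvd_mult_cancel)
        (simp add: Ep_def Op_def prod_odd_nth_0[simplified] prod_even_nth_0[simplified])
  qed
  then show ?thesis by simp
qed

text \<open>As all exponents are odd, q -> -q swaps the factors 1 - q^(2i+1) and 1 + q^(2i+1),
  turning the product into its inverse.\<close>

lemma OPF_mult_OPF_uminus: "OPF * (OPF oo - fps_X) = 1"
proof -
  have "OPF * (OPF oo - fps_X) - 1 = 0"
  proof (rule fps_eq_0_if_X_power_dvd)
    fix N
    define Om where "Om = (\<Prod>i<N. 1 - fps_X ^ (2 * i + 1) :: int fps)"
    define Op where "Op = (\<Prod>i<N. 1 + fps_X ^ (2 * i + 1) :: int fps)"
    have X: "(- fps_X :: int fps) $ 0 = 0" by simp
    have pow: "fps_X ^ k oo - fps_X = (- fps_X :: int fps) ^ k" for k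
      by (simp flip: fps_compose_power)
    have 1: "fps_X ^ (2 * N) dvd OPF * Om - Op"
      using OPF_dvd unfolding Om_def Op_def .
    then have "(fps_X ^ (2 * N) oo - fps_X) dvd (OPF * Om - Op oo - fps_X)"
      by (rule fps_compose_dvd[OF _ X])
    moreover have "Om oo - fps_X = Op" "Op oo - fps_X = Om"
      unfolding Om_def Op_def
      by (simp_all add: fps_compose_prod_distrib[OF X] fps_compose_sub_distrib fps_compose_add_distrib
          pow power_add del: power_Suc)
    ultimately have 2: "fps_X ^ (2 * N) dvd (OPF oo - fps_X) * Op - Om"
      by (simp add: fps_compose_sub_distrib fps_compose_mult_distrib[OF X] pow)
    have "(OPF * (OPF oo - fps_X) - 1) * Op =
        OPF * ((OPF oo - fps_X) * Op - Om) + (OPF * Om - Op)"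
      by (simp add: algebra_simps)
    then have "fps_X ^ (2 * N) dvd (OPF * (OPF oo - fps_X) - 1) * Op"
      using 1 2 by (simp only: dvd_add dvd_mult)
    then show "fps_X ^ (2 * N) dvd OPF * (OPF oo - fps_X) - 1"
      by (rule fps_X_power_dvd_mult_cancel) (simp add: Op_def prod_odd_nth_0[simplified])
  qed
  then show ?thesis by simp
qed


text \<open>Multiply \<open>OPF_mult_alternating_theta\<close> by its image under q -> -q. The
  right-hand side, a series in q^2, is unchanged, and the two generating functions cancel.\<close>

lemma theta_mult_alternating_theta:
  "theta * (theta oo - fps_X) = (theta oo - fps_X oo fps_X\<^sup>2)\<^sup>2"
proof -
  let ?\<psi> = "theta oo - fps_X"
  have X: "(- fps_X :: int fps) $ 0 = 0" "(fps_X\<^sup>2 :: int fps) $ 0 = 0" by simp_all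
  have "(OPF oo - fps_X) * (?\<psi> oo - fps_X) = (?\<psi> oo fps_X\<^sup>2 oo - fps_X)"
    using arg_cong[OF OPF_mult_alternating_theta, of "\<lambda>f. f oo - fps_X"]
    by (simp only: fps_compose_mult_distrib[OF X(1)])
  moreover have "?\<psi> oo - fps_X = theta"
    by (simp add: fps_compose_uminus' fps_eq_iff minus_one_power_iff)
  moreover have "fps_X\<^sup>2 oo - fps_X = (fps_X\<^sup>2 :: int fps)"
    unfolding fps_compose_power[OF X(1), symmetric] by simp
  then have "(?\<psi> oo fps_X\<^sup>2 oo - fps_X) = (?\<psi> oo fps_X\<^sup>2)"
    by (simp flip: fps_compose_assoc[OF X])
  ultimately have *: "(OPF oo - fps_X) * theta = (?\<psi> oo fps_X\<^sup>2)" by simp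
  have "theta * ?\<psi> = (OPF * (OPF oo - fps_X)) * (theta * ?\<psi>)"
    by (simp add: OPF_mult_OPF_uminus)
  also have "\<dots> = (OPF * ?\<psi>) * ((OPF oo - fps_X) * theta)" by (simp only: mult_ac)
  finally show ?thesis unfolding * OPF_mult_alternating_theta by (simp add: power2_eq_square)
qed

text \<open>The previous identity at q^k; \<open>m\<close> stands apart so that numerals such as 4
  and 8 match directly.\<close>

lemma theta_compose_power:
  assumes "k > 0" "m = 2 * k"
  shows "(theta oo fps_X ^ k) * (theta oo - fps_X oo fps_X ^ k) =
         (theta oo - fps_X oo fps_X ^ m)\<^sup>2"
proof -
  have X: "(fps_X ^ k :: int fps) $ 0 = 0" using assms by simp
  have "(fps_X\<^sup>2 :: int fps) oo fps_X ^ k = fps_X ^ m"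
    unfolding fps_compose_power[OF X, symmetric] fps_X_fps_compose_startby0[OF X]
    by (simp add: assms(2) mult.commute flip: power_mult)
  then have "(theta oo - fps_X oo fps_X\<^sup>2) oo fps_X ^ k = (theta oo - fps_X oo fps_X ^ m)"
    using fps_compose_assoc[OF X, of "fps_X\<^sup>2" "theta oo - fps_X"] by simp
  then show ?thesis
    using arg_cong[OF theta_mult_alternating_theta, of "\<lambda>f. f oo fps_X ^ k"]
    by (simp only: fps_compose_mult_distrib[OF X] fps_compose_power[OF X, symmetric])
qed

text \<open>First \<open>theta = OPF * \<psi> 2\<close>; then \<phi>(q^2) turns
  \<open>\<psi> 2\<close> into the square of \<open>\<psi> 4\<close>, and the square of \<phi>(q^4)
  turns that into the fourth power of \<open>\<psi> 8\<close>.\<close>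

lemma OPF_mult_alternating_theta_8:
  "OPF * (theta oo - fps_X oo fps_X ^ 8) ^ 4 =
     theta * (theta oo fps_X ^ 2) * (theta oo fps_X ^ 4)\<^sup>2"
proof -
  define \<psi> where "\<psi> k = theta oo - fps_X oo fps_X ^ k" for k
  define \<phi> where "\<phi> k = theta oo fps_X ^ k" for k
  have 4: "\<phi> 2 * \<psi> 2 = (\<psi> 4)\<^sup>2" and 8: "\<phi> 4 * \<psi> 4 = (\<psi> 8)\<^sup>2"
    unfolding \<psi>_def \<phi>_def by (rule theta_compose_power; simp)+
  have "OPF * \<psi> 2 * \<psi> 2 = (OPF * (theta oo - fps_X)) * theta"
    using theta_mult_alternating_theta unfolding \<psi>_def by (simp only: power2_eq_square mult_ac)
  also have "\<dots> = theta * \<psi> 2"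
    unfolding OPF_mult_alternating_theta \<psi>_def by (rule mult.commute)
  finally have "(OPF * \<psi> 2 - theta) * \<psi> 2 = 0"
    by (simp add: algebra_simps)
  moreover have "\<psi> 2 $ 0 = 1"
    unfolding \<psi>_def by (simp add: theta_def)
  then have "\<psi> 2 \<noteq> 0" by auto
  ultimately have theta: "theta = OPF * \<psi> 2" by simp
  have "theta * \<phi> 2 * (\<phi> 4)\<^sup>2 = OPF * (\<phi> 2 * \<psi> 2) * (\<phi> 4)\<^sup>2"
    unfolding theta by (simp only: mult_ac)
  also have "\<dots> = OPF * (\<phi> 4 * \<psi> 4)\<^sup>2"
    unfolding 4 by (simp only: power_mult_distrib mult_ac)
  also have "\<dots> = OPF * \<psi> 8 ^ 4"
    unfolding 8 by (simp flip: power_mult)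
  finally show ?thesis unfolding \<psi>_def \<phi>_def by (rule sym)
qed

section \<open>Divisibility by residue class\<close>

text \<open>One exponent of 2 for each residue mod 8, as an explicit list, so that the side
  conditions below become finite numerical checks.\<close>

definition class_dvd :: "nat list \<Rightarrow> int fps \<Rightarrow> bool" where
  "class_dvd v f \<longleftrightarrow> (\<forall>n. 2 ^ (v ! (n mod 8)) dvd f $ n)"

lemma mod_8_cases: "n mod 8 \<in> {0,1,2,3,4,5,6,7::nat}"
  by (simp, arith)

text \<open>Coefficients convolve, so exponents combine by (min, +) convolution over the residues
  mod 8; \<open>w\<close> must stay below the result.\<close>

lemma class_dvd_mult:
  assumes "class_dvd u f" "class_dvd v g"
    and le: "\<forall>a\<in>{0,1,2,3,4,5,6,7}. \<forall>b\<in>{0,1,2,3,4,5,6,7}. w ! ((a + b) mod 8) \<le> u ! a + v ! b"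
  shows "class_dvd w (f * g)"
  unfolding class_dvd_def fps_mult_nth
proof (intro allI dvd_sum)
  fix n i :: nat assume "i \<in> {0..n}"
  then have "(i mod 8 + (n - i) mod 8) mod 8 = n mod 8"
    by (simp add: mod_add_eq)
  then have "w ! (n mod 8) \<le> u ! (i mod 8) + v ! ((n - i) mod 8)"
    using bspec[OF bspec[OF le mod_8_cases] mod_8_cases, of i "n - i"] by simp
  then have "(2::int) ^ (w ! (n mod 8)) dvd 2 ^ (u ! (i mod 8)) * 2 ^ (v ! ((n - i) mod 8))"
    unfolding power_add[symmetric] by (rule le_imp_power_dvd)
  also have "\<dots> dvd f $ i * g $ (n - i)"
    using assms(1,2) unfolding class_dvd_def by (intro mult_dvd_mono) auto
  finally show "2 ^ (w ! (n mod 8)) dvd f $ i * g $ (n - i)" .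
qed

lemma class_dvd_add:
  assumes "class_dvd v f" "class_dvd v g"
  shows "class_dvd v (f + g)"
  using assms unfolding class_dvd_def by simp

lemma class_dvd_const_mult:
  assumes "class_dvd u f" "\<forall>a\<in>{0,1,2,3,4,5,6,7}. v ! a \<le> k + u ! a"
  shows "class_dvd v (fps_const (2 ^ k) * f)"
  unfolding class_dvd_def fps_mult_left_const_nth
proof
  fix n
  have "(2::int) ^ (v ! (n mod 8)) dvd 2 ^ k * 2 ^ (u ! (n mod 8))"
    unfolding power_add[symmetric] by (intro le_imp_power_dvd bspec[OF assms(2) mod_8_cases])
  also have "\<dots> dvd 2 ^ k * f $ n"
    using assms(1) unfolding class_dvd_def by (intro mult_dvd_mono) auto
  finally show "2 ^ (v ! (n mod 8)) dvd 2 ^ k * f $ n" .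
qed

lemma fps_compose_X_power_nth:
  fixes f :: "'a::comm_ring_1 fps"
  assumes "m > 0"
  shows "(f oo fps_X ^ m) $ n = (if m dvd n then f $ (n div m) else 0)"
proof -
  have "(f oo fps_X ^ m) $ n = (\<Sum>i=0..n. if n = m * i then f $ i else 0)"
    unfolding fps_compose_nth power_mult[symmetric] fps_X_power_nth
    by (intro sum.cong) auto
  also have "\<dots> = (if m dvd n then f $ (n div m) else 0)"
  proof (cases "m dvd n")
    case True
    then have "n = m * i \<longleftrightarrow> i = n div m" for i using assms by auto
    then show ?thesis using True by simp
  next
    case False
    then show ?thesis by (auto intro!: sum.neutral)
  qed
  finally show ?thesis .
qed

text \<open>Only exponents m i occur, and m i mod 8 depends only on i mod 8; entries of
  \<open>v\<close> at residues not of the form m a are unrestricted.\<close>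

lemma class_dvd_compose:
  assumes "class_dvd u f" "m > 0" "\<forall>a\<in>{0,1,2,3,4,5,6,7}. v ! (m * a mod 8) \<le> u ! a"
  shows "class_dvd v (f oo fps_X ^ m)"
  unfolding class_dvd_def
proof
  fix n
  show "2 ^ (v ! (n mod 8)) dvd (f oo fps_X ^ m) $ n"
  proof (cases "m dvd n")
    case True
    then obtain i where i: "n = m * i" by (elim dvdE)
    have "v ! (m * (i mod 8) mod 8) \<le> u ! (i mod 8)"
      by (rule bspec[OF assms(3) mod_8_cases])
    then have "(2::int) ^ (v ! (n mod 8)) dvd 2 ^ (u ! (i mod 8))"
      unfolding i mod_mult_right_eq by (rule le_imp_power_dvd)
    also have "\<dots> dvd f $ i" using assms(1) by (simp add: class_dvd_def)
    finally show ?thesis using assms(2) by (simp add: fps_compose_X_power_nth i)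
  qed (simp add: fps_compose_X_power_nth assms(2))
qed

text \<open>The second factor has constant term 1 and only exponents divisible by 8. Hence a
  coefficient of \<open>f\<close> is one of the product minus a combination of earlier coefficients
  of \<open>f\<close> in the same residue class.\<close>

lemma class_dvd_mult_cancel:
  assumes fg: "class_dvd v (f * (g oo fps_X ^ 8))" and "g $ 0 = 1"
  shows "class_dvd v f"
proof -
  have "2 ^ (v ! (n mod 8)) dvd f $ n" for n
  proof (induction n rule: less_induct)
    case (less n)
    let ?h = "g oo fps_X ^ 8"
    have "(f * ?h) $ n = f $ n * ?h $ 0 + (\<Sum>i<n. f $ i * ?h $ (n - i))"
      by (simp add: fps_mult_nth atLeast0AtMost flip: lessThan_Suc_atMost)
    then have "f $ n = (f * ?h) $ n - (\<Sum>i<n. f $ i * ?h $ (n - i))"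
      using assms(2) by simp
    moreover have "2 ^ (v ! (n mod 8)) dvd (\<Sum>i<n. f $ i * ?h $ (n - i))"
    proof (rule dvd_sum)
      fix i assume i: "i \<in> {..<n}"
      show "2 ^ (v ! (n mod 8)) dvd f $ i * ?h $ (n - i)"
      proof (cases "8 dvd n - i")
        case True
        then have "n mod 8 = i mod 8"
          using i by (metis lessThan_iff less_imp_le mod_eq_dvd_iff_nat)
        then show ?thesis using less.IH[of i] i by (simp only: lessThan_iff dvd_mult2)
      qed (simp add: fps_compose_X_power_nth)
    qed
    moreover have "2 ^ (v ! (n mod 8)) dvd (f * ?h) $ n"
      using fg by (simp only: class_dvd_def)
    ultimately show ?case by (simp only: dvd_diff)
  qed
  then show ?thesis unfolding class_dvd_def by blast
qed

section \<open>Squares modulo 8 and bounds for powers of theta\<close>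

lemma square_mod_8:
  assumes "is_square (n::nat)"
  shows "n mod 8 = 0 \<or> n mod 8 = 1 \<or> n mod 8 = 4"
proof -
  obtain m where m: "n = m\<^sup>2" using assms by (elim is_nth_powerE)
  have "n mod 8 = (m mod 8)\<^sup>2 mod 8" unfolding m by (simp add: power_mod)
  then show ?thesis using mod_8_cases[of m] by auto
qed

text \<open>In these lists an entry \<open>4\<close> also stands for coefficients that vanish.\<close>

lemma class_dvd_theta: "class_dvd [0,1,4,4,1,4,4,4] theta"
  unfolding class_dvd_def
proof
  fix n
  show "2 ^ ([0,1,4,4,1,4,4,4] ! (n mod 8)) dvd theta $ n"
    using square_mod_8[of n] by (auto simp: theta_def)
qed

text \<open>Even squares are 4 times squares and give the series at q^4; odd squares are 1 mod 8 and
  form \<open>g\<close>. The splitting exposes the factor 2 of the cross term in the square of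
  \<open>theta\<close>.\<close>

lemma theta_decompose:
  obtains g where "theta = (theta oo fps_X ^ 4) + g" "class_dvd [4,1,4,4,4,4,4,4] g"
proof
  let ?g = "theta - (theta oo fps_X ^ 4)"
  show "theta = (theta oo fps_X ^ 4) + ?g" by simp
  have even: "?g $ n = 0" if "even n" for n
  proof -
    have "is_square n \<longleftrightarrow> 4 dvd n \<and> is_square (n div 4)"
    proof
      assume "is_square n"
      then obtain m where m: "n = m\<^sup>2" by (elim is_nth_powerE)
      with that have "even m" by simp
      then obtain l where "m = 2 * l" by (elim dvdE)
      then show "4 dvd n \<and> is_square (n div 4)" using m by (auto simp: power_mult_distrib)
    next
      assume "4 dvd n \<and> is_square (n div 4)"
      then obtain l where "n = 4 * l\<^sup>2" by (auto elim!: is_nth_powerE dvdE)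
      then have "n = (2 * l)\<^sup>2" by (simp add: power_mult_distrib)
      then show "is_square n" by (simp only: is_nth_power_nth_power)
    qed
    then show ?thesis by (auto simp: fps_compose_X_power_nth theta_def)
  qed
  show "class_dvd [4,1,4,4,4,4,4,4] ?g"
    unfolding class_dvd_def
  proof
    fix n
    show "2 ^ ([4,1,4,4,4,4,4,4] ! (n mod 8)) dvd ?g $ n"
    proof (cases "even n")
      case False
      then have "\<not> 4 dvd n" by (meson dvd_trans even_numeral)
      then have g: "?g $ n = (if is_square n then 2 else 0)"
        using False odd_pos[OF False] by (auto simp: theta_def fps_compose_X_power_nth)
      have "n mod 8 = 1" if "is_square n"
        using square_mod_8[OF that] False by presburger
      then show ?thesis unfolding g by auto
    qed (simp add: even del: fps_sub_nth)
  qed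
qed

text \<open>Squaring 1 + 2 S gives 1 + 4 (S + S^2), so all nonconstant coefficients are multiples of
  4; substituting q^4 leaves only the residues 0 and 4.\<close>

lemma class_dvd_theta_compose_4_power2: "class_dvd [0,4,4,4,2,4,4,4] ((theta oo fps_X ^ 4)\<^sup>2)"
proof -
  define S :: "int fps" where "S = Abs_fps (\<lambda>n. if n > 0 \<and> is_square n then 1 else 0)"
  have theta: "theta = 1 + 2 * S"
    by (auto simp: theta_def S_def fps_eq_iff numeral_fps_const)
  have "theta\<^sup>2 = 1 + fps_const 4 * (S + S\<^sup>2)"
    unfolding theta numeral_fps_const[symmetric] by (simp add: power2_eq_square algebra_simps)
  then have nth: "theta\<^sup>2 $ n = 4 * (S + S\<^sup>2) $ n" if "n > 0" for n
    using that by simp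
  have "class_dvd [0,2,2,2,2,2,2,2] (theta\<^sup>2)"
    unfolding class_dvd_def
  proof
    fix n
    have le: "\<forall>a\<in>{0,1,2,3,4,5,6,7}. [0,2,2,2,2,2,2,2] ! a \<le> (2::nat)" by simp
    show "2 ^ ([0,2,2,2,2,2,2,2] ! (n mod 8)) dvd theta\<^sup>2 $ n"
    proof (cases "n = 0")
      case False
      have "(2::int) ^ ([0,2,2,2,2,2,2,2] ! (n mod 8)) dvd 2\<^sup>2"
        by (rule le_imp_power_dvd, rule bspec[OF le mod_8_cases])
      also have "2\<^sup>2 dvd theta\<^sup>2 $ n" using False by (simp only: nth) simp
      finally show ?thesis .
    qed simp
  qed
  then have "class_dvd [0,4,4,4,2,4,4,4] (theta\<^sup>2 oo fps_X ^ 4)"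
    by (rule class_dvd_compose) simp_all
  then show ?thesis by (simp add: fps_compose_power)
qed

lemma class_dvd_theta_power2: "class_dvd [0,2,2,4,2,3,4,4] (theta\<^sup>2)"
proof -
  obtain g where g: "theta = (theta oo fps_X ^ 4) + g" "class_dvd [4,1,4,4,4,4,4,4] g"
    by (rule theta_decompose)
  let ?a = "theta oo fps_X ^ 4"
  have a: "class_dvd [0,4,4,4,1,4,4,4] ?a"
    by (rule class_dvd_compose[OF class_dvd_theta]) simp_all
  \<comment> \<open>The factor 2^0 serves only to lower the listed exponents.\<close>
  have "class_dvd [0,2,2,4,2,3,4,4] (fps_const (2 ^ 0) * ?a\<^sup>2)"
    by (rule class_dvd_const_mult[OF class_dvd_theta_compose_4_power2]) simp
  moreover have "class_dvd [4,1,4,4,4,2,4,4] (?a * g)"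
    by (rule class_dvd_mult[OF a g(2)]) simp
  \<comment> \<open>The factor 2 raises the exponents at residues 1 and 5 to 2 and 3, which squaring
    the bound for \<open>theta\<close> alone would miss.\<close>
  then have "class_dvd [0,2,2,4,2,3,4,4] (fps_const (2 ^ 1) * (?a * g))"
    by (rule class_dvd_const_mult) simp
  moreover have "class_dvd [0,2,2,4,2,3,4,4] (g * g)"
    by (rule class_dvd_mult[OF g(2) g(2)]) simp
  ultimately have "class_dvd [0,2,2,4,2,3,4,4]
      (fps_const (2 ^ 0) * ?a\<^sup>2 + fps_const (2 ^ 1) * (?a * g) + g * g)"
    by (intro class_dvd_add)
  also have "fps_const (2 ^ 0) * ?a\<^sup>2 + fps_const (2 ^ 1) * (?a * g) + g * g = (?a + g)\<^sup>2"
    by (simp add: power2_eq_square algebra_simps flip: numeral_fps_const)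
  finally show ?thesis using g(1) by simp
qed

section \<open>Bounds for the generating function and its odd powers\<close>

lemma class_dvd_OPF: "class_dvd [0,1,1,2,1,3,2,4] OPF"
proof (rule class_dvd_mult_cancel)
  have 2: "class_dvd [0,4,1,4,4,4,4,4] (theta oo fps_X ^ 2)"
    by (rule class_dvd_compose[OF class_dvd_theta]) simp_all
  have "class_dvd [0,1,1,2,1,4,2,4] (theta * (theta oo fps_X ^ 2))"
    by (rule class_dvd_mult[OF class_dvd_theta 2]) simp
  \<comment> \<open>Residue 5 now arises as 1 + 4 with exponent 1 + 2, and residue 7 as 1 + 2 + 4
    with exponent 1 + 1 + 2, the source of the moduli 8 and 16.\<close>
  then have "class_dvd [0,1,1,2,1,3,2,4] (theta * (theta oo fps_X ^ 2) * (theta oo fps_X ^ 4)\<^sup>2)"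
    by (rule class_dvd_mult[OF _ class_dvd_theta_compose_4_power2]) simp
  then show "class_dvd [0,1,1,2,1,3,2,4] (OPF * ((theta oo - fps_X) ^ 4 oo fps_X ^ 8))"
    by (simp add: OPF_mult_alternating_theta_8 flip: fps_compose_power)
qed (simp add: fps_nth_power_0 theta_def)

text \<open>The square of the same identity, with the bounds for the squared theta series. The
  entries are the least for which the criterion of \<open>class_dvd_mult\<close> preserves the list
  of \<open>class_dvd_OPF\<close>.\<close>

lemma class_dvd_OPF_power2: "class_dvd [0,2,1,3,2,3,3,4] (OPF\<^sup>2)"
proof (rule class_dvd_mult_cancel)
  have "class_dvd [0,4,2,4,2,4,4,4] (theta\<^sup>2 oo fps_X ^ 2)"
    by (rule class_dvd_compose[OF class_dvd_theta_power2]) simp_all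
  then have 2: "class_dvd [0,4,2,4,2,4,4,4] ((theta oo fps_X ^ 2)\<^sup>2)"
    by (simp add: fps_compose_power)
  have 4: "class_dvd [0,4,4,4,2,4,4,4] ((theta oo fps_X ^ 4)\<^sup>2 * (theta oo fps_X ^ 4)\<^sup>2)"
    by (rule class_dvd_mult[OF class_dvd_theta_compose_4_power2
          class_dvd_theta_compose_4_power2]) simp
  have "class_dvd [0,2,2,4,2,3,4,4] (theta\<^sup>2 * (theta oo fps_X ^ 2)\<^sup>2)"
    by (rule class_dvd_mult[OF class_dvd_theta_power2 2]) simp
  then have "class_dvd [0,2,1,3,2,3,3,4] (theta\<^sup>2 * (theta oo fps_X ^ 2)\<^sup>2 *
      ((theta oo fps_X ^ 4)\<^sup>2 * (theta oo fps_X ^ 4)\<^sup>2))"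
    by (rule class_dvd_mult[OF _ 4]) simp
  also have "theta\<^sup>2 * (theta oo fps_X ^ 2)\<^sup>2 *
      ((theta oo fps_X ^ 4)\<^sup>2 * (theta oo fps_X ^ 4)\<^sup>2) =
      (OPF * (theta oo - fps_X oo fps_X ^ 8) ^ 4)\<^sup>2"
    unfolding OPF_mult_alternating_theta_8 by (simp only: power2_eq_square mult_ac)
  finally show "class_dvd [0,2,1,3,2,3,3,4] (OPF\<^sup>2 * ((theta oo - fps_X) ^ 8 oo fps_X ^ 8))"
    by (simp add: power_mult_distrib flip: fps_compose_power power_mult)
qed (simp add: fps_nth_power_0 theta_def)

lemma class_dvd_OPF_odd_power: "class_dvd [0,1,1,2,1,3,2,4] (OPF ^ (2 * k + 1))"
proof (induction k)
  case (Suc k)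
  have "class_dvd [0,1,1,2,1,3,2,4] (OPF ^ (2 * k + 1) * OPF\<^sup>2)"
    by (rule class_dvd_mult[OF Suc.IH class_dvd_OPF_power2]) simp
  then show ?case by (simp add: power2_eq_square mult_ac)
qed (use class_dvd_OPF in simp)

theorem theorem2p10:
  fixes n k :: nat
  shows "[OPT (2 * k + 1) (8 * n + 1) = 0] (mod 2) \<and>
         [OPT (2 * k + 1) (8 * n + 2) = 0] (mod 2) \<and>
         [OPT (2 * k + 1) (8 * n + 3) = 0] (mod 4) \<and>
         [OPT (2 * k + 1) (8 * n + 4) = 0] (mod 2) \<and>
         [OPT (2 * k + 1) (8 * n + 5) = 0] (mod 8) \<and>
         [OPT (2 * k + 1) (8 * n + 6) = 0] (mod 4) \<and>
         [OPT (2 * k + 1) (8 * n + 7) = 0] (mod 16)"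
proof -
  have *: "2 ^ ([0,1,1,2,1,3,2,4] ! (m mod 8)) dvd OPT (2 * k + 1) m" for m
  proof -
    have "int (2 ^ ([0,1,1,2,1,3,2,4] ! (m mod 8))) dvd int (OPT (2 * k + 1) m)"
      using class_dvd_OPF_odd_power[of k] unfolding class_dvd_def OPT_eq_fps_nth by simp
    then show ?thesis by (simp only: int_dvd_int_iff)
  qed
  have r: "(8 * n + i) mod 8 = i mod 8" for i by simp
  show ?thesis
    using *[of "8 * n + 1"] *[of "8 * n + 2"] *[of "8 * n + 3"] *[of "8 * n + 4"]
      *[of "8 * n + 5"] *[of "8 * n + 6"] *[of "8 * n + 7"]
    unfolding r cong_0_iff by simp
qed

end
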